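(* Let $(\mathcal{V}, \|\cdot\|_{\mathcal{V}})$ and $(\mathcal{W}, \|\cdot\|_{\mathcal{W}})$ be real Banach spaces, and let $L : \mathcal{V} \rightarrow \mathcal{W}$ be a bounded, surjective linear operator with Banach space adjoint $L^* : \mathcal{W}^* \to \mathcal{V}^*$. Then, for any $g\in\mathcal{W}^*$, $$\|g\|_{L\uparrow\mathcal{V}}^* = \|g\|_{L^*\downarrow\mathcal{V}^*}.$$ On the other hand, if $\mathcal{V}$ and $\mathcal{W}$ are reflexive and $M : \mathcal{W}^* \rightarrow \mathcal{V}^*$ is a bounded, injective linear operator with closed image and Banach space adjoint $M^* : \mathcal{V}^{**} \to \mathcal{W}^{**}$, then for any $\psi \in \mathcal{W}^{**}$, $$\|\psi\|_{M\downarrow\mathcal{V}^*}^* = \|\psi\|_{M^*\uparrow\mathcal{V}^{**}}.$$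
   Context: For a real normed space $\mathcal{X}$, $\mathcal{X}^*$ denotes its continuous dual, endowed with the dual norm $\|f\|_{\mathcal{X}^*} = \|f\|_{\mathcal X}^* = \sup_{\|x\|_{\mathcal{X}}\le 1} f(x)$, and $\mathcal{X}^{**} = (\mathcal{X}^* )^*$. For a bounded linear operator $T:\mathcal{X}\to\mathcal{Y}$ between Banach spaces, the Banach space adjoint $T^*:\mathcal{Y}^*\to\mathcal{X}^*$ is $T^*(f)(x) = f(T(x))$. For normed spaces $\mathcal{X},\mathcal{Y}$ and a linear operator $T:\mathcal{X}\to\mathcal{Y}$, the push-forward (extended) seminorm on $\mathcal{Y}$ induced by $T$ is $\|y\|_{T\uparrow\mathcal{X}} := \inf_{T(x)=y}\|x\|_{\mathcal{X}}$ (equal to $\infty$ if no $x$ satisfies $T(x)=y$), and the pull-back seminorm on $\mathcal{X}$ induced by $T$ is $\|x\|_{T\downarrow\mathcal{Y}} := \|T(x)\|_{\mathcal{Y}}$. The superscript $*$ on these seminorms denotes the dual norm: $\|g\|^*_{L\uparrow\mathcal{V}} = \sup\{g(w) : w\in\mathcal{W},\ \|w\|_{L\uparrow\mathcal{V}}\le 1\}$ and $\|\psi\|^*_{M\downarrow\mathcal{V}^*} = \sup\{\psi(g) : g\in\mathcal{W}^*,\ \|M(g)\|_{\mathcal{V}^*}\le 1\}$. Explicitly, $\|g\|_{L^*\downarrow\mathcal{V}^*} = \|L^*(g)\|_{\mathcal{V}^*}$ and $\|\psi\|_{M^*\uparrow\mathcal{V}^{**}} = \inf\{\|\varphi\|_{\mathcal{V}^{**}}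 : \varphi\in\mathcal{V}^{**},\ M^*(\varphi)=\psi\}$. *)

theory Defs
  imports "HOL-Analysis.Analysis"
begin

text \<open>
  The continuous dual of \<open>'a\<close> is the type \<open>'a \<Rightarrow>\<^sub>L real\<close> and the bidual is
  \<open>('a \<Rightarrow>\<^sub>L real) \<Rightarrow>\<^sub>L real\<close>. Extended seminorms are functions into \<^typ>\<open>ereal\<close>.
\<close>

definition banach_adjoint ::
  "('a::real_normed_vector \<Rightarrow>\<^sub>L 'b::real_normed_vector) \<Rightarrow> ('b \<Rightarrow>\<^sub>L real) \<Rightarrow>\<^sub>L ('a \<Rightarrow>\<^sub>L real)"
  where "banach_adjoint T = Blinfun (\<lambda>f. f o\<^sub>L T)"

lemma banach_adjoint_apply: "blinfun_apply (blinfun_apply (banach_adjoint T) f) x = f (T x)"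
  by (simp add: banach_adjoint_def bounded_linear_Blinfun_apply
      bounded_bilinear.bounded_linear_left[OF bounded_bilinear_blinfun_compose])

definition canonical_embedding :: "'a::real_normed_vector \<Rightarrow> ('a \<Rightarrow>\<^sub>L real) \<Rightarrow>\<^sub>L real"
  where "canonical_embedding x = Blinfun (\<lambda>f. blinfun_apply f x)"

lemma canonical_embedding_apply: "blinfun_apply (canonical_embedding x) f = f x"
  by (simp add: canonical_embedding_def bounded_linear_Blinfun_apply)

definition reflexive_space :: "'a::real_normed_vector itself \<Rightarrow> bool"
  where "reflexive_space _ \<longleftrightarrow> surj (canonical_embedding :: 'a \<Rightarrow> ('a \<Rightarrow>\<^sub>L real) \<Rightarrow>\<^sub>L real)"

text \<open>If \<open>y\<close> is not in the range of \<open>T\<close>, the infimum is over the empty set and equals \<open>\<infinity>\<close>.\<close>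

definition pushforward_seminorm :: "('a::real_normed_vector \<Rightarrow> 'b) \<Rightarrow> 'b \<Rightarrow> ereal"
  where "pushforward_seminorm T y = (INF x\<in>{x. T x = y}. ereal (norm x))"

definition pullback_seminorm :: "('a \<Rightarrow> 'b::real_normed_vector) \<Rightarrow> 'a \<Rightarrow> ereal"
  where "pullback_seminorm T x = ereal (norm (T x))"

definition dual_seminorm :: "('a::real_normed_vector \<Rightarrow> ereal) \<Rightarrow> ('a \<Rightarrow>\<^sub>L real) \<Rightarrow> ereal"
  where "dual_seminorm p f = (SUP x\<in>{x. p x \<le> 1}. ereal (f x))"

text \<open>
  The library defines the norm of a bounded linear functional as the supremum of
  \<open>\<bar>f x\<bar> / norm x\<close>; it agrees with the supremum of \<open>f x\<close> over the closed unit ball.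
\<close>

lemma dual_seminorm_norm: "dual_seminorm (\<lambda>x. ereal (norm x)) f = ereal (norm f)"
proof (rule antisym)
  show "dual_seminorm (\<lambda>x. ereal (norm x)) f \<le> ereal (norm f)"
    unfolding dual_seminorm_def
  proof (rule SUP_least)
    fix x :: 'a assume "x \<in> {x. ereal (norm x) \<le> 1}"
    then have "norm x \<le> 1" by (simp add: one_ereal_def)
    have "f x \<le> norm f * norm x" using norm_blinfun[of f x] by simp
    also have "\<dots> \<le> norm f * 1" using \<open>norm x \<le> 1\<close> by (intro mult_left_mono) auto
    finally show "ereal (f x) \<le> ereal (norm f)" by simp
  qed
  show "ereal (norm f) \<le> dual_seminorm (\<lambda>x. ereal (norm x)) f" (is "_ \<le> ?S")
  proof (cases ?S)
    case (real s)
    have le: "f x \<le> s" if "norm x \<le> 1" for x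
    proof -
      have "ereal (f x) \<le> ?S"
        unfolding dual_seminorm_def using that by (intro SUP_upper) (simp add: one_ereal_def)
      then show ?thesis using real by simp
    qed
    have "norm f \<le> s"
    proof (rule norm_blinfun_bound)
      show "0 \<le> s" using le[of 0] by simp
      fix x :: 'a
      show "norm (f x) \<le> s * norm x"
      proof (cases "x = 0")
        case False
        have "f (x /\<^sub>R norm x) \<le> s" "f (- (x /\<^sub>R norm x)) \<le> s"
          using False by (intro le; simp)+
        then have "f x \<le> s * norm x" "- f x \<le> s * norm x"
          using False by (simp_all add: blinfun.bilinear_simps field_simps)
        then show ?thesis by simp
      qed simp
    qed
    then show ?thesis using real by simp
  next
    case MInf
    have "ereal (f 0) \<le> ?S"
      unfolding dual_seminorm_def by (rule SUP_upper) simp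
    then show ?thesis using MInf by simp
  qed simp
qed

end

theory Submission
  imports Defs
begin

text \<open>
  The first identity is a comparison of suprema: up to a factor \<open>1 + e\<close>, every \<open>w\<close> in the unit ball
  of the push-forward seminorm is the image of a vector of norm at most \<open>1\<close>, so both sides are the
  supremum of \<open>g (L x)\<close> over the unit ball of the domain.

  In the second identity, if \<open>\<phi>\<close> is a preimage of \<open>\<psi>\<close> under the adjoint of \<open>M\<close>, then
  \<open>\<psi> g = \<phi> (M g) \<le> norm \<phi>\<close> whenever \<open>norm (M g) \<le> 1\<close>, which gives one inequality. For the
  other one, let \<open>s\<close> be the dual seminorm of \<open>\<psi>\<close>, assumed finite. Then
  \<open>\<psi> g \<le> s * norm (M g)\<close> for all \<open>g\<close>, and \<open>\<psi>\<close> has to factor as \<open>\<phi> \<circ> M\<close> with \<open>norm \<phi> \<le> s\<close>.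
  This is an instance of the Hahn--Banach theorem. It is proved here in the form of Mazur and Orlicz
  (\<open>mazur_orlicz\<close>): a sublinear functional \<open>p\<close> dominates a linear functional that satisfies
  prescribed lower bounds \<open>b \<le> f a\<close> for all \<open>(a, b)\<close> in a convex cone, as soon as \<open>b \<le> p a\<close>
  there. In this form no functionals on subspaces occur. A single construction, lowering a sublinear
  functional along a convex cone (\<open>sublinear_lower_along_cone\<close>), both enforces the bounds and
  shows that the minimal sublinear functionals supplied by Zorn's lemma are linear.
\<close>

section \<open>Sublinear functionals\<close>

text \<open>
  Inequality suffices in the homogeneity condition: applied to \<open>inverse t\<close> it gives the reverse
  inequality, and with \<open>t = 1/2\<close> it forces the value \<open>0\<close> at the origin.
\<close>

definition sublinear :: "('a::real_vector \<Rightarrow> real) \<Rightarrow> bool"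
  where "sublinear p \<longleftrightarrow>
    (\<forall>x y. p (x + y) \<le> p x + p y) \<and> (\<forall>t x. 0 < t \<longrightarrow> p (t *\<^sub>R x) \<le> t * p x)"

lemma sublinear_add: "sublinear p \<Longrightarrow> p (x + y) \<le> p x + p y"
  by (simp add: sublinear_def)

lemma sublinear_scaleR_le: "sublinear p \<Longrightarrow> 0 < t \<Longrightarrow> p (t *\<^sub>R x) \<le> t * p x"
  by (simp add: sublinear_def)

lemma sublinear_zero:
  assumes "sublinear p"
  shows "p 0 = 0"
  using sublinear_add[OF assms, of 0 0] sublinear_scaleR_le[OF assms, of "1/2" 0] by simp

lemma sublinear_scaleR:
  assumes p: "sublinear p" and "0 \<le> t"
  shows "p (t *\<^sub>R x) = t * p x"
proof (cases "t = 0")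
  case False
  with \<open>0 \<le> t\<close> have t: "0 < t" by simp
  have "p x \<le> inverse t * p (t *\<^sub>R x)"
    using sublinear_scaleR_le[OF p, of "inverse t" "t *\<^sub>R x"] t by simp
  then have "t * p x \<le> p (t *\<^sub>R x)"
    using t by (simp add: field_simps)
  then show ?thesis
    using sublinear_scaleR_le[OF p t, of x] by simp
qed (simp add: sublinear_zero[OF p])

lemma sublinear_minus_ge: "sublinear p \<Longrightarrow> - p (- x) \<le> p x"
  using sublinear_add[of p x "- x"] by (simp add: sublinear_zero)

lemma sublinear_norm: "0 \<le> s \<Longrightarrow> sublinear (\<lambda>x::'a::real_normed_vector. s * norm x)"
  unfolding sublinear_def
  by (auto simp: mult.left_commute distrib_left[symmetric] intro!: mult_left_mono norm_triangle_ineq)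

text \<open>
  A pointwise infimum is subadditive only if bounds at \<open>x\<close> and at \<open>y\<close> that come from
  different members of the family are combined by a third one. This covers both chains and
  families indexed by a convex cone.
\<close>

lemma sublinear_INF:
  fixes f :: "'i \<Rightarrow> 'a::real_vector \<Rightarrow> real"
  assumes ne: "I \<noteq> {}"
    and bdd: "\<And>x. bdd_below ((\<lambda>i. f i x) ` I)"
    and add: "\<And>i j x y. i \<in> I \<Longrightarrow> j \<in> I \<Longrightarrow> \<exists>k\<in>I. f k (x + y) \<le> f i x + f j y"
    and scale: "\<And>i t x. i \<in> I \<Longrightarrow> 0 < t \<Longrightarrow> \<exists>k\<in>I. f k (t *\<^sub>R x) \<le> t * f i x"
  shows "sublinear (\<lambda>x. INF i\<in>I. f i x)"
  unfolding sublinear_def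
proof (intro conjI allI impI)
  fix x y
  have "(INF k\<in>I. f k (x + y)) - f i x \<le> f j y" if "i \<in> I" "j \<in> I" for i j
  proof -
    obtain k where "k \<in> I" "f k (x + y) \<le> f i x + f j y"
      using add[OF \<open>i \<in> I\<close> \<open>j \<in> I\<close>] by blast
    then have "(INF k\<in>I. f k (x + y)) \<le> f i x + f j y"
      by (rule cINF_lower2[OF bdd])
    then show ?thesis by simp
  qed
  then have "(INF k\<in>I. f k (x + y)) - f i x \<le> (INF j\<in>I. f j y)" if "i \<in> I" for i
    using that by (intro cINF_greatest[OF ne])
  then have "(INF k\<in>I. f k (x + y)) - (INF j\<in>I. f j y) \<le> f i x" if "i \<in> I" for i
    using that by (simp add: algebra_simps)
  then have "(INF k\<in>I. f k (x + y)) - (INF j\<in>I. f j y) \<le> (INF i\<in>I. f i x)"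
    by (intro cINF_greatest[OF ne])
  then show "(INF k\<in>I. f k (x + y)) \<le> (INF i\<in>I. f i x) + (INF j\<in>I. f j y)"
    by simp
next
  fix t :: real and x
  assume t: "0 < t"
  have "(INF k\<in>I. f k (t *\<^sub>R x)) / t \<le> f i x" if "i \<in> I" for i
  proof -
    obtain k where "k \<in> I" "f k (t *\<^sub>R x) \<le> t * f i x"
      using scale[OF \<open>i \<in> I\<close> t] by blast
    then have "(INF k\<in>I. f k (t *\<^sub>R x)) \<le> t * f i x"
      by (rule cINF_lower2[OF bdd])
    then show ?thesis using t by (simp add: field_simps)
  qed
  then have "(INF k\<in>I. f k (t *\<^sub>R x)) / t \<le> (INF i\<in>I. f i x)"
    by (intro cINF_greatest[OF ne])
  then show "(INF k\<in>I. f k (t *\<^sub>R x)) \<le> t * (INF i\<in>I. f i x)"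
    using t by (simp add: field_simps)
qed

text \<open>
  The functional \<open>q x = (INF (a, b)\<in>C. p (x + a) - b)\<close> does it: \<open>b \<le> p a\<close> keeps the infimum
  above \<open>- p (- x)\<close>, and the choice \<open>x = - a\<close> leaves \<open>p 0 - b\<close>. The bound is imposed at
  \<open>- a\<close> because a linear \<open>f \<le> q\<close> then satisfies \<open>f a = - f (- a) \<ge> b\<close>.
\<close>

lemma sublinear_lower_along_cone:
  fixes p :: "'a::real_vector \<Rightarrow> real"
  assumes p: "sublinear p" and C: "convex_cone C"
    and le: "\<And>a b. (a, b) \<in> C \<Longrightarrow> b \<le> p a"
  obtains q where "sublinear q" "q \<le> p" "\<And>a b. (a, b) \<in> C \<Longrightarrow> q (- a) \<le> - b"
proof
  define f where "f c x = p (x + fst c) - snd c" for c and x :: 'a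
  define q where "q x = (INF c\<in>C. f c x)" for x
  have zero: "(0, 0) \<in> C"
    using C by (simp add: convex_cone_iff zero_prod_def)
  have "- p (- x) \<le> f c x" if "c \<in> C" for c x
  proof -
    have "snd c \<le> p (fst c)"
      using le[of "fst c" "snd c"] that by simp
    also have "\<dots> \<le> p (x + fst c) + p (- x)"
      using sublinear_add[OF p, of "x + fst c" "- x"] by simp
    finally show ?thesis by (simp add: f_def)
  qed
  then have bdd: "bdd_below ((\<lambda>c. f c x) ` C)" for x
    by (rule bdd_belowI2)
  have qle: "q x \<le> f c x" if "c \<in> C" for c x
    unfolding q_def using that by (rule cINF_lower[OF bdd])
  have "sublinear (\<lambda>x. INF c\<in>C. f c x)"
  proof (rule sublinear_INF[OF _ bdd])
    show "C \<noteq> {}" using zero by blast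
  next
    fix c d x y
    assume "c \<in> C" "d \<in> C"
    moreover have "f (c + d) (x + y) \<le> f c x + f d y"
      using sublinear_add[OF p, of "x + fst c" "y + fst d"] by (simp add: f_def algebra_simps)
    ultimately show "\<exists>k\<in>C. f k (x + y) \<le> f c x + f d y"
      using convex_cone_add[OF C] by blast
  next
    fix c x and t :: real
    assume "c \<in> C" "0 < t"
    moreover have "f (t *\<^sub>R c) (t *\<^sub>R x) \<le> t * f c x"
      using sublinear_scaleR_le[OF p \<open>0 < t\<close>, of "x + fst c"] by (simp add: f_def algebra_simps)
    ultimately show "\<exists>k\<in>C. f k (t *\<^sub>R x) \<le> t * f c x"
      using convex_cone_scaleR[OF C, of t c] by auto
  qed
  then show "sublinear q" by (simp add: q_def[abs_def])
  show "q \<le> p"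
    using qle[OF zero] by (simp add: le_fun_def f_def)
  show "q (- a) \<le> - b" if "(a, b) \<in> C" for a b
    using qle[OF that, of "- a"] by (simp add: f_def sublinear_zero[OF p])
qed

section \<open>The Mazur--Orlicz form of the Hahn--Banach theorem\<close>

text \<open>
  Lowering \<open>p\<close> along the ray through \<open>(a, p a)\<close> cannot change a minimal \<open>p\<close>, so
  \<open>p (- a) \<le> - p a\<close>. An odd sublinear functional is linear.
\<close>

lemma minimal_sublinear_linear:
  fixes p :: "'a::real_vector \<Rightarrow> real"
  assumes p: "sublinear p" and min: "\<And>q. sublinear q \<Longrightarrow> q \<le> p \<Longrightarrow> q = p"
  shows "linear p"
proof -
  have odd: "p (- a) = - p a" for a
  proof -
    define C where "C = (\<lambda>t. t *\<^sub>R (a, p a)) ` {0..}"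
    have "convex_cone C"
      unfolding convex_cone_iff C_def
    proof (intro conjI ballI allI impI)
      show "0 \<in> (\<lambda>t. t *\<^sub>R (a, p a)) ` {0..}"
        by (rule image_eqI[of _ _ 0]) (simp_all add: zero_prod_def)
    next
      fix x y
      assume "x \<in> (\<lambda>t. t *\<^sub>R (a, p a)) ` {0..}" "y \<in> (\<lambda>t. t *\<^sub>R (a, p a)) ` {0..}"
      then obtain s t where "x = s *\<^sub>R (a, p a)" "y = t *\<^sub>R (a, p a)" "0 \<le> s" "0 \<le> t"
        by auto
      then show "x + y \<in> (\<lambda>t. t *\<^sub>R (a, p a)) ` {0..}"
        by (intro image_eqI[of _ _ "s + t"]) (simp_all add: algebra_simps)
    next
      fix x and c :: real
      assume "x \<in> (\<lambda>t. t *\<^sub>R (a, p a)) ` {0..}" "0 \<le> c"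
      then obtain t where "x = t *\<^sub>R (a, p a)" "0 \<le> t" by auto
      then show "c *\<^sub>R x \<in> (\<lambda>t. t *\<^sub>R (a, p a)) ` {0..}"
        using \<open>0 \<le> c\<close> by (intro image_eqI[of _ _ "c * t"]) simp_all
    qed
    moreover have "b \<le> p x" if "(x, b) \<in> C" for x b
      using that by (auto simp: C_def sublinear_scaleR[OF p])
    ultimately obtain q where q: "sublinear q" "q \<le> p"
      and qC: "\<And>x b. (x, b) \<in> C \<Longrightarrow> q (- x) \<le> - b"
      using sublinear_lower_along_cone[OF p] by blast
    have "(a, p a) \<in> C"
      unfolding C_def by (rule image_eqI[of _ _ 1]) simp_all
    then have "p (- a) \<le> - p a"
      using qC min[OF q] by blast
    then show ?thesis
      using sublinear_minus_ge[OF p, of a] by simp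
  qed
  show ?thesis
  proof (rule linearI)
    fix x y
    have "p x \<le> p (x + y) - p y"
      using sublinear_add[OF p, of "x + y" "- y"] by (simp add: odd)
    then show "p (x + y) = p x + p y"
      using sublinear_add[OF p, of x y] by simp
  next
    fix t x
    show "p (t *\<^sub>R x) = t *\<^sub>R p x"
    proof (cases "0 \<le> t")
      case False
      then show ?thesis
        using sublinear_scaleR[OF p, of "- t" x] odd[of "t *\<^sub>R x"] by simp
    qed (simp add: sublinear_scaleR[OF p])
  qed
qed

text \<open>
  Zorn's lemma gives a minimal sublinear functional below \<open>p\<close>. The pointwise infimum of a chain is
  finite because a sublinear \<open>q \<le> p\<close> satisfies \<open>q x \<ge> - q (- x) \<ge> - p (- x)\<close>.
\<close>

lemma linear_below_sublinear:
  fixes p :: "'a::real_vector \<Rightarrow> real"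
  assumes p: "sublinear p"
  obtains f where "linear f" "f \<le> p"
proof -
  define A where "A = {q. sublinear q \<and> q \<le> p}"
  have "\<exists>m\<in>A. \<forall>q\<in>A. m \<ge> q \<longrightarrow> q = m"
  proof (rule predicate_Zorn)
    show "partial_order_on A (relation_of (\<ge>) A)"
      by (rule partial_order_on_relation_ofI) auto
  next
    fix C
    assume C: "C \<in> Chains (relation_of (\<ge>) A)"
    have CA: "C \<subseteq> A" by (rule Chains_relation_of[OF C])
    have total: "q \<le> r \<or> r \<le> q" if "q \<in> C" "r \<in> C" for q r
      using C that unfolding Chains_def relation_of_def by auto
    show "\<exists>u\<in>A. \<forall>q\<in>C. q \<ge> u"
    proof (cases "C = {}")
      case True
      then show ?thesis using p by (auto simp: A_def)
    next
      case False
      define u where "u x = (INF q\<in>C. q x)" for x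
      have "- p (- x) \<le> q x" if "q \<in> C" for q x
      proof -
        have "sublinear q" "q (- x) \<le> p (- x)"
          using CA that by (auto simp: A_def le_fun_def)
        then show ?thesis
          using sublinear_minus_ge[of q x] by simp
      qed
      then have bdd: "bdd_below ((\<lambda>q. q x) ` C)" for x
        by (rule bdd_belowI2)
      have ule: "u \<le> q" if "q \<in> C" for q
        unfolding le_fun_def u_def using cINF_lower[OF bdd that] by blast
      have "sublinear (\<lambda>x. INF q\<in>C. q x)"
      proof (rule sublinear_INF[OF False bdd])
        fix q r and x y :: 'a
        assume qr: "q \<in> C" "r \<in> C"
        then have sub: "sublinear q" "sublinear r"
          using CA by (auto simp: A_def)
        show "\<exists>k\<in>C. k (x + y) \<le> q x + r y"
          using total[OF qr]
        proof
          assume "q \<le> r"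
          then have "q (x + y) \<le> q x + r y"
            using sublinear_add[OF sub(1), of x y] by (auto simp: le_fun_def intro: order_trans)
          then show ?thesis using qr by blast
        next
          assume "r \<le> q"
          then have "r (x + y) \<le> q x + r y"
            using sublinear_add[OF sub(2), of x y] by (auto simp: le_fun_def intro: order_trans)
          then show ?thesis using qr by blast
        qed
      next
        fix q and t :: real and x :: 'a
        assume "q \<in> C" "0 < t"
        then show "\<exists>k\<in>C. k (t *\<^sub>R x) \<le> t * q x"
          using CA sublinear_scaleR_le by (fastforce simp: A_def)
      qed
      then have "sublinear u" by (simp add: u_def[abs_def])
      moreover obtain r where "r \<in> C"
        using False by blast
      then have "u \<le> p"
        using ule[of r] CA by (auto simp: A_def)
      ultimately show ?thesis
        using ule by (auto simp: A_def)
    qed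
  qed
  then obtain m where "sublinear m" "m \<le> p" and "\<And>q. q \<in> A \<Longrightarrow> q \<le> m \<Longrightarrow> q = m"
    by (auto simp: A_def)
  then have "linear m"
    by (intro minimal_sublinear_linear) (auto simp: A_def intro: order_trans)
  then show thesis using \<open>m \<le> p\<close> by (rule that)
qed

theorem mazur_orlicz:
  fixes p :: "'a::real_vector \<Rightarrow> real"
  assumes "sublinear p" and "convex_cone C"
    and "\<And>a b. (a, b) \<in> C \<Longrightarrow> b \<le> p a"
  obtains f where "linear f" "f \<le> p" "\<And>a b. (a, b) \<in> C \<Longrightarrow> b \<le> f a"
proof -
  obtain q where q: "sublinear q" "q \<le> p" and qC: "\<And>a b. (a, b) \<in> C \<Longrightarrow> q (- a) \<le> - b"
    using sublinear_lower_along_cone[OF assms] by blast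
  obtain f where f: "linear f" "f \<le> q"
    using linear_below_sublinear[OF q(1)] by blast
  have "b \<le> f a" if "(a, b) \<in> C" for a b
  proof -
    have "f (- a) \<le> q (- a)"
      using f(2) by (simp add: le_fun_def)
    then show ?thesis
      using qC[OF that] linear_neg[OF f(1), of a] by simp
  qed
  then show thesis
    using f q(2) by (intro that[of f]) auto
qed

text \<open>
  The graph of \<open>(M, \<psi>)\<close> is a subspace, hence a convex cone; the lower bound at \<open>- g\<close> is an
  upper bound at \<open>g\<close>, so the Mazur--Orlicz functional agrees with \<open>\<psi>\<close> along \<open>M\<close>.
\<close>

corollary factor_functional_through_operator:
  fixes M :: "'a::real_normed_vector \<Rightarrow>\<^sub>L 'b::real_normed_vector" and \<psi> :: "'a \<Rightarrow>\<^sub>L real"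
  assumes s: "0 \<le> s" and le: "\<And>g. \<psi> g \<le> s * norm (M g)"
  obtains \<phi> :: "'b \<Rightarrow>\<^sub>L real" where "norm \<phi> \<le> s" "\<And>g. \<phi> (M g) = \<psi> g"
proof -
  define C where "C = range (\<lambda>g. (M g, \<psi> g))"
  have "linear (\<lambda>g. (M g, \<psi> g))"
    by (rule linearI) (simp_all add: blinfun.bilinear_simps)
  then have "subspace C"
    unfolding C_def by (rule linear_subspace_image) simp
  then have "convex_cone C"
    by (simp add: convex_cone_iff subspace_def)
  moreover have "b \<le> s * norm a" if "(a, b) \<in> C" for a b
    using that le by (auto simp: C_def)
  ultimately obtain f where f: "linear f" "f \<le> (\<lambda>x. s * norm x)"
    and fC: "\<And>a b. (a, b) \<in> C \<Longrightarrow> b \<le> f a"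
    using mazur_orlicz[OF sublinear_norm[OF s]] by blast
  have abs_le: "norm (f x) \<le> s * norm x" for x
    using le_funD[OF f(2), of x] le_funD[OF f(2), of "- x"] linear_neg[OF f(1), of x] by simp
  have "bounded_linear f"
    using f(1) abs_le by (intro bounded_linear_intro[where K = s])
      (simp_all add: linear_add linear_scale mult.commute)
  then have f_apply: "blinfun_apply (Blinfun f) = f"
    by (rule bounded_linear_Blinfun_apply)
  show thesis
  proof (rule that)
    show "norm (Blinfun f) \<le> s"
      using abs_le s by (intro norm_blinfun_bound) (simp_all add: f_apply)
    fix g
    have "\<psi> h \<le> f (M h)" for h
      by (rule fC) (simp add: C_def)
    from this[of g] this[of "- g"] show "Blinfun f (M g) = \<psi> g"
      by (simp add: f_apply blinfun.bilinear_simps linear_neg[OF f(1)])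
  qed
qed

section \<open>Duality of push-forward and pull-back seminorms\<close>

lemma dual_pushforward_seminorm:
  fixes L :: "'a::real_normed_vector \<Rightarrow>\<^sub>L 'b::real_normed_vector"
  shows "dual_seminorm (pushforward_seminorm L) g = pullback_seminorm (banach_adjoint L) g"
proof (rule antisym)
  let ?N = "norm (banach_adjoint L g)"
  show "dual_seminorm (pushforward_seminorm L) g \<le> pullback_seminorm (banach_adjoint L) g"
    unfolding dual_seminorm_def pullback_seminorm_def
  proof (rule SUP_least)
    fix w
    assume "w \<in> {w. pushforward_seminorm L w \<le> 1}"
    then have w: "pushforward_seminorm L w \<le> 1" by simp
    have "g w \<le> ?N + e" if "0 < e" for e
    proof -
      \<comment> \<open>The infimum may not be attained; \<open>d\<close> makes the excess \<open>?N * d\<close> at most \<open>e\<close>,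
        and the summand \<open>1\<close> guards against \<open>?N = 0\<close>.\<close>
      define d where "d = e / (?N + 1)"
      have d: "0 < d" "?N * d \<le> e"
        using that by (simp_all add: d_def field_simps add_pos_nonneg)
      have "pushforward_seminorm L w < ereal (1 + d)"
        by (rule le_less_trans[OF w]) (simp add: one_ereal_def d(1))
      then obtain x where x: "L x = w" "norm x < 1 + d"
        by (auto simp: pushforward_seminorm_def INF_less_iff)
      have "g w = banach_adjoint L g x"
        using x(1) by (simp add: banach_adjoint_apply)
      also have "\<dots> \<le> ?N * norm x"
        using norm_blinfun[of "banach_adjoint L g" x] by simp
      also have "\<dots> \<le> ?N * (1 + d)"
        using x(2) by (intro mult_left_mono) auto
      also have "\<dots> \<le> ?N + e"
        using d(2) by (simp add: distrib_left)
      finally show ?thesis .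
    qed
    then show "ereal (g w) \<le> ereal ?N"
      by (simp add: field_le_epsilon)
  qed
  have "ereal ?N = dual_seminorm (\<lambda>x. ereal (norm x)) (banach_adjoint L g)"
    by (rule dual_seminorm_norm[symmetric])
  also have "\<dots> \<le> dual_seminorm (pushforward_seminorm L) g"
    unfolding dual_seminorm_def
  proof (rule SUP_least)
    fix x :: 'a
    assume x: "x \<in> {x. ereal (norm x) \<le> 1}"
    have "pushforward_seminorm L (L x) \<le> ereal (norm x)"
      unfolding pushforward_seminorm_def by (rule INF_lower) simp
    then have "L x \<in> {w. pushforward_seminorm L w \<le> 1}"
      using x by (auto intro: order_trans)
    then show "ereal (banach_adjoint L g x) \<le> (SUP w\<in>{w. pushforward_seminorm L w \<le> 1}. ereal (g w))"
      unfolding banach_adjoint_apply by (rule SUP_upper)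
  qed
  finally show "pullback_seminorm (banach_adjoint L) g \<le> dual_seminorm (pushforward_seminorm L) g"
    by (simp add: pullback_seminorm_def)
qed

text \<open>
  By homogeneity, a finite dual seminorm is an operator bound. Where \<open>M g = 0\<close>, all multiples of
  \<open>g\<close> lie in the unit ball of the pull-back seminorm, so \<open>\<psi>\<close> cannot be positive there.
\<close>

lemma dual_pullback_seminorm_bound:
  fixes M :: "'a::real_normed_vector \<Rightarrow>\<^sub>L 'b::real_normed_vector"
  assumes s: "dual_seminorm (pullback_seminorm M) \<psi> = ereal s"
  shows "\<psi> g \<le> s * norm (M g)"
proof -
  have le: "\<psi> h \<le> s" if "norm (M h) \<le> 1" for h
  proof -
    have "ereal (\<psi> h) \<le> dual_seminorm (pullback_seminorm M) \<psi>"
      unfolding dual_seminorm_def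
      by (rule SUP_upper) (use that in \<open>simp add: pullback_seminorm_def one_ereal_def\<close>)
    then show ?thesis by (simp add: s)
  qed
  show ?thesis
  proof (cases "M g = 0")
    case True
    have "\<psi> g \<le> 0"
    proof (rule ccontr)
      assume "\<not> \<psi> g \<le> 0"
      moreover have "\<psi> (((s + 1) / \<psi> g) *\<^sub>R g) \<le> s"
        using True by (intro le) (simp add: blinfun.bilinear_simps)
      ultimately show False by (simp add: blinfun.bilinear_simps)
    qed
    then show ?thesis using True by simp
  next
    case False
    then have "\<psi> (g /\<^sub>R norm (M g)) \<le> s"
      by (intro le) (simp add: blinfun.bilinear_simps)
    then show ?thesis
      using False by (simp add: blinfun.bilinear_simps field_simps)
  qed
qed

lemma dual_pullback_seminorm:
  fixes M :: "'a::real_normed_vector \<Rightarrow>\<^sub>L 'b::real_normed_vector"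
  shows "dual_seminorm (pullback_seminorm M) \<psi> = pushforward_seminorm (banach_adjoint M) \<psi>"
proof (rule antisym)
  show "dual_seminorm (pullback_seminorm M) \<psi> \<le> pushforward_seminorm (banach_adjoint M) \<psi>"
    unfolding dual_seminorm_def pushforward_seminorm_def
  proof (intro SUP_least INF_greatest)
    fix g \<phi>
    assume "g \<in> {g. pullback_seminorm M g \<le> 1}" "\<phi> \<in> {\<phi>. banach_adjoint M \<phi> = \<psi>}"
    then have g: "norm (M g) \<le> 1" and \<phi>: "\<psi> = banach_adjoint M \<phi>"
      by (auto simp: pullback_seminorm_def one_ereal_def)
    have "\<psi> g = \<phi> (M g)"
      by (simp add: \<phi> banach_adjoint_apply)
    also have "\<dots> \<le> norm \<phi> * norm (M g)"
      using norm_blinfun[of \<phi> "M g"] by simp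
    also have "\<dots> \<le> norm \<phi>"
      using g by (simp add: mult_left_le)
    finally show "ereal (\<psi> g) \<le> ereal (norm \<phi>)" by simp
  qed
  have nonneg: "0 \<le> dual_seminorm (pullback_seminorm M) \<psi>"
    unfolding dual_seminorm_def
    by (rule SUP_upper2[of 0]) (simp_all add: pullback_seminorm_def)
  show "pushforward_seminorm (banach_adjoint M) \<psi> \<le> dual_seminorm (pullback_seminorm M) \<psi>"
  proof (cases "dual_seminorm (pullback_seminorm M) \<psi>")
    case (real s)
    have "0 \<le> s" using nonneg real by simp
    then obtain \<phi> :: "'b \<Rightarrow>\<^sub>L real" where \<phi>: "norm \<phi> \<le> s" "\<And>g. \<phi> (M g) = \<psi> g"
      using factor_functional_through_operator dual_pullback_seminorm_bound[OF real] by blast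
    have "banach_adjoint M \<phi> = \<psi>"
      by (rule blinfun_eqI) (simp add: banach_adjoint_apply \<phi>(2))
    then have "pushforward_seminorm (banach_adjoint M) \<psi> \<le> ereal (norm \<phi>)"
      unfolding pushforward_seminorm_def by (intro INF_lower) simp
    then show ?thesis
      using \<phi>(1) real by (auto intro: order_trans)
  qed (use nonneg in simp_all)
qed

theorem theorem3p7:
  shows "(\<forall>L :: 'v::banach \<Rightarrow>\<^sub>L 'w::banach. surj (blinfun_apply L) \<longrightarrow>
           (\<forall>g :: 'w \<Rightarrow>\<^sub>L real.
              dual_seminorm (pushforward_seminorm (blinfun_apply L)) g
                = pullback_seminorm (blinfun_apply (banach_adjoint L)) g))
       \<and> (reflexive_space TYPE('v) \<and> reflexive_space TYPE('w) \<longrightarrow>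
           (\<forall>M :: ('w \<Rightarrow>\<^sub>L real) \<Rightarrow>\<^sub>L ('v \<Rightarrow>\<^sub>L real).
              inj (blinfun_apply M) \<and> closed (range (blinfun_apply M)) \<longrightarrow>
              (\<forall>\<psi> :: ('w \<Rightarrow>\<^sub>L real) \<Rightarrow>\<^sub>L real.
                 dual_seminorm (pullback_seminorm (blinfun_apply M)) \<psi>
                   = pushforward_seminorm (blinfun_apply (banach_adjoint M)) \<psi>)))"
  by (simp add: dual_pushforward_seminorm dual_pullback_seminorm)

end
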